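(* Let $p$ be a real polynomial of degree at most $3$. Then (1) $L_n(p)$ is increasing in $n$ if and only if $p(0)\leq\min\big\{p(1),\,p\big(\tfrac12\big)\big\}$; (2) $L_n(p)$ is decreasing in $n$ if and only if $p(0)\geq\max\big\{p(1),\,p\big(\tfrac12\big)\big\}$; (3) $R_n(p)$ is increasing in $n$ if and only if $p(1)\leq\min\big\{p(0),\,p\big(\tfrac12\big)\big\}$; (4) $R_n(p)$ is decreasing in $n$ if and only if $p(1)\geq\max\big\{p(0),\,p\big(\tfrac12\big)\big\}$.
   Context: For $f:[0,1]\to\mathbb{R}$ and an integer $n\ge 1$, the left and right Riemann sums of $f$ are $L_n(f):=\frac1n\sum_{k=0}^{n-1}f\big(\tfrac kn\big)$ and $R_n(f):=\frac1n\sum_{k=1}^{n}f\big(\tfrac kn\big)$. "Increasing" and "decreasing" (in $n$) are meant in the weak (non-strict) sense, over integers $n\geq 1$. *)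

theory Defs
  imports Complex_Main "HOL-Computational_Algebra.Polynomial"
begin

(* Functions on [0,1] are represented by total functions on the reals; for n >= 1 only
   their values on [0,1] are used. At n = 0 both sums are 0 by the convention 1 / 0 = 0. *)

definition left_Riemann_sum :: "(real \<Rightarrow> real) \<Rightarrow> nat \<Rightarrow> real" where
  "left_Riemann_sum f n = 1 / real n * (\<Sum>k = 0..n - 1. f (real k / real n))"

definition right_Riemann_sum :: "(real \<Rightarrow> real) \<Rightarrow> nat \<Rightarrow> real" where
  "right_Riemann_sum f n = 1 / real n * (\<Sum>k = 1..n. f (real k / real n))"

end

theory Submission
  imports Defs
begin

text \<open>
  For a cubic \<open>p\<close> the Euler--Maclaurin expansion of the Riemann sums terminates: with
  \<open>B = (p 1 - p 0) / 2\<close> and a suitable constant \<open>C\<close>, the left sum is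
  \<open>I - B / n + C / n\<^sup>2\<close> and the right sum is \<open>I + B / n + C / n\<^sup>2\<close>. The cubic enters only
  through \<open>I\<close>, \<open>B\<close> and \<open>C\<close>, so everything reduces to the monotonicity of a quadratic in \<open>1 / n\<close>.

  The difference of two values of \<open>I - B u + C u\<^sup>2\<close> at \<open>u = 1 / m\<close> and \<open>v = 1 / n\<close> has the
  factor \<open>B - C (u + v)\<close>, which is affine in \<open>u + v\<close>. For distinct positive integers the sums
  \<open>u + v\<close> lie in \<open>(0, 3/2]\<close>, where \<open>3/2\<close> is attained by \<open>1\<close> and \<open>2\<close> and \<open>0\<close> is
  approached in the limit. Hence the factor is nonnegative for all of them exactly if it is so at
  the two ends, i.e. if \<open>B \<ge> 0\<close> and \<open>B - 3 C / 2 \<ge> 0\<close>. For the left sum these two numbers are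
  \<open>(p 1 - p 0) / 2\<close> and \<open>p (1/2) - p 0\<close>. Decreasing sums follow by negating all coefficients.
  Passing to the right sum replaces \<open>B\<close> by \<open>- B\<close>, and \<open>- B - 3 C / 2 = p (1/2) - p 1\<close>.
\<close>

lemma mono_on_quadratic_in_inverse_iff:
  fixes I B C :: real and f :: "nat \<Rightarrow> real"
  assumes f: "\<And>n. n \<ge> 1 \<Longrightarrow> f n = I - B / real n + C / (real n)\<^sup>2"
  shows "mono_on {1..} f \<longleftrightarrow> 0 \<le> B \<and> 0 \<le> B - 3 / 2 * C"
proof -
  have diff: "f n - f m = (1 / real m - 1 / real n) * (B - C * (1 / real m + 1 / real n))"
    if "m \<ge> 1" "n \<ge> 1" for m n
    using that by (simp add: f power2_eq_square algebra_simps)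
  show ?thesis
  proof
    assume mono: "mono_on {1..} f"
    have "f 1 \<le> f 2"
      using mono by (rule mono_onD) auto
    then have "0 \<le> B - 3 / 2 * C"
      by (simp add: f power2_eq_square)
    moreover have "0 \<le> B"
    proof (rule LIMSEQ_le_const)
      \<comment> \<open>Comparing \<open>n + 1\<close> with \<open>2 (n + 1)\<close> makes the factor \<open>u + v\<close> a multiple of \<open>1 / (n + 1)\<close>.\<close>
      show "(\<lambda>n. B - C * (3 / 2) * (1 / real (Suc n))) \<longlonglongrightarrow> B"
        using tendsto_diff[OF tendsto_const[of B]
            tendsto_mult_right_zero[OF LIMSEQ_Suc[OF lim_1_over_n], of "C * (3 / 2)"]]
        by (simp only: diff_0_right)
      have "0 \<le> B - C * (3 / 2) * (1 / real (Suc n))" for n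
      proof -
        have "f (Suc n) \<le> f (2 * Suc n)"
          using mono by (rule mono_onD) auto
        then have "0 \<le> (1 / real (Suc n) - 1 / real (2 * Suc n)) *
            (B - C * (1 / real (Suc n) + 1 / real (2 * Suc n)))"
          using diff[of "Suc n" "2 * Suc n"] by simp
        moreover have "1 / real (Suc n) - 1 / real (2 * Suc n) > 0"
          by (simp add: field_simps)
        ultimately have "0 \<le> B - C * (1 / real (Suc n) + 1 / real (2 * Suc n))"
          by (simp only: zero_le_mult_iff) linarith
        moreover have "1 / real (Suc n) + 1 / real (2 * Suc n) = 3 / 2 * (1 / real (Suc n))"
          by (simp add: divide_simps)
        ultimately show ?thesis
          by (simp only: mult.assoc)
      qed
      then show "\<exists>N. \<forall>n\<ge>N. 0 \<le> B - C * (3 / 2) * (1 / real (Suc n))"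
        by blast
    qed
    ultimately show "0 \<le> B \<and> 0 \<le> B - 3 / 2 * C"
      by simp
  next
    assume BC: "0 \<le> B \<and> 0 \<le> B - 3 / 2 * C"
    show "mono_on {1..} f"
    proof (rule mono_onI)
      fix m n :: nat
      assume mn: "m \<in> {1..}" "n \<in> {1..}" "m \<le> n"
      show "f m \<le> f n"
      proof (cases "m = n")
        case False
        define s where "s = 1 / real m + 1 / real n"
        have "1 / real m \<le> 1"
          using mn by simp
        moreover have "1 / real n \<le> 1 / 2"
          using mn False by (intro divide_left_mono) auto
        ultimately have s: "0 \<le> s" "s \<le> 3 / 2"
          by (auto simp: s_def)
        have "0 \<le> B - C * s"
        proof (cases "0 \<le> C")
          case True
          then have "C * s \<le> C * (3 / 2)"
            using s by (intro mult_left_mono)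
          then show ?thesis
            using BC by linarith
        next
          case False
          then have "C * s \<le> 0"
            using s by (intro mult_nonpos_nonneg) auto
          then show ?thesis
            using BC by linarith
        qed
        moreover have "0 \<le> 1 / real m - 1 / real n"
          using mn by (simp add: frac_le)
        ultimately have "0 \<le> f n - f m"
          using diff[of m n] mn by (simp add: s_def)
        then show ?thesis
          by simp
      qed simp
    qed
  qed
qed

lemma antimono_on_quadratic_in_inverse_iff:
  fixes I B C :: real and f :: "nat \<Rightarrow> real"
  assumes f: "\<And>n. n \<ge> 1 \<Longrightarrow> f n = I - B / real n + C / (real n)\<^sup>2"
  shows "antimono_on {1..} f \<longleftrightarrow> B \<le> 0 \<and> B - 3 / 2 * C \<le> 0"
proof -
  have "antimono_on {1..} f \<longleftrightarrow> mono_on {1..} (\<lambda>n. - f n)"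
    by (auto simp: monotone_on_def)
  also have "\<dots> \<longleftrightarrow> 0 \<le> - B \<and> 0 \<le> - B - 3 / 2 * (- C)"
    by (rule mono_on_quadratic_in_inverse_iff[of _ "- I"]) (simp add: f)
  finally show ?thesis
    by auto
qed

text \<open>
  The denominator \<open>N\<close> is kept independent of the number of terms so that induction on the latter
  goes through.
\<close>

lemma sum_cubic:
  fixes a b c d N :: real
  assumes "N \<noteq> 0"
  shows "(\<Sum>k = 0..m. a + b * (real k / N) + c * (real k / N)\<^sup>2 + d * (real k / N) ^ 3) =
    a * (real m + 1) + b * (real m * (real m + 1) / 2) / N
      + c * (real m * (real m + 1) * (2 * real m + 1) / 6) / N\<^sup>2
      + d * (real m * (real m + 1) / 2)\<^sup>2 / N ^ 3"
  using assms
  by (induction m) (simp_all add: divide_simps, algebra)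

lemma poly_eq_cubic_if_degree_le_3:
  fixes p :: "'a::comm_semiring_1 poly"
  assumes "degree p \<le> 3"
  shows "poly p x = coeff p 0 + coeff p 1 * x + coeff p 2 * x\<^sup>2 + coeff p 3 * x ^ 3"
proof -
  have "poly p x = (\<Sum>i\<le>3. coeff p i * x ^ i)"
    unfolding poly_altdef using assms
    by (intro sum.mono_neutral_left) (auto simp: coeff_eq_0)
  then show ?thesis
    by (simp add: numeral_eq_Suc)
qed

text \<open>
  The Euler--Maclaurin coefficient of \<open>1 / n\<^sup>2\<close> is \<open>(p' 1 - p' 0) / 12\<close>. For cubics this difference
  of derivatives equals \<open>4 (p 0 + p 1 - 2 p (1/2))\<close>, since second differences of a cubic around
  \<open>1/2\<close> see only its even part there. The form with values of \<open>p\<close> is the one in which the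
  monotonicity criterion can be read off.
\<close>

lemma left_Riemann_sum_cubic:
  fixes p :: "real poly"
  assumes deg: "degree p \<le> 3"
  obtains I where "\<And>n. n \<ge> 1 \<Longrightarrow> left_Riemann_sum (poly p) n =
    I - (poly p 1 - poly p 0) / 2 / real n
      + (poly p 0 + poly p 1 - 2 * poly p (1 / 2)) / 3 / (real n)\<^sup>2"
proof -
  define a b c d where coeffs: "a = coeff p 0" "b = coeff p 1" "c = coeff p 2" "d = coeff p 3"
  have p: "poly p x = a + b * x + c * x\<^sup>2 + d * x ^ 3" for x
    unfolding coeffs by (rule poly_eq_cubic_if_degree_le_3[OF deg])
  have "left_Riemann_sum (poly p) n =
    (a + b / 2 + c / 3 + d / 4) - (poly p 1 - poly p 0) / 2 / real n
      + (poly p 0 + poly p 1 - 2 * poly p (1 / 2)) / 3 / (real n)\<^sup>2"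
    if n1: "n \<ge> 1" for n
  proof -
    obtain m where n: "n = Suc m"
      using n1 by (cases n) auto
    define N where "N = real n"
    have N: "N \<noteq> 0" "real m = N - 1" and m: "n - 1 = m"
      using n by (auto simp: N_def)
    have "left_Riemann_sum (poly p) n = 1 / N *
        (a * (N - 1 + 1) + b * ((N - 1) * (N - 1 + 1) / 2) / N
          + c * ((N - 1) * (N - 1 + 1) * (2 * (N - 1) + 1) / 6) / N\<^sup>2
          + d * ((N - 1) * (N - 1 + 1) / 2)\<^sup>2 / N ^ 3)"
      unfolding left_Riemann_sum_def p N_def[symmetric] m sum_cubic[OF N(1)] N(2) ..
    also have "\<dots> = (a + b / 2 + c / 3 + d / 4) - (b + c + d) / 2 / N + (c / 6 + d / 4) / N\<^sup>2"
      using N(1) by (simp add: divide_simps) algebra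
    also have "b + c + d = poly p 1 - poly p 0"
      by (simp add: p)
    also have "c / 6 + d / 4 = (poly p 0 + poly p 1 - 2 * poly p (1 / 2)) / 3"
      by (simp add: p power2_eq_square power3_eq_cube)
    finally show ?thesis
      by (simp only: N_def)
  qed
  then show thesis
    by (rule that)
qed

lemma right_Riemann_sum_eq_left:
  assumes "n \<ge> 1"
  shows "right_Riemann_sum f n = left_Riemann_sum f n + (f 1 - f 0) / real n"
proof -
  obtain m where n: "n = Suc m"
    using assms by (cases n) auto
  have "f 0 + (\<Sum>k = 1..n. f (real k / real n)) = (\<Sum>k = 0..n. f (real k / real n))"
    by (simp add: sum.atLeast_Suc_atMost[of 0 n])
  also have "\<dots> = (\<Sum>k = 0..n - 1. f (real k / real n)) + f 1"
    using n by simp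
  finally have "(\<Sum>k = 1..n. f (real k / real n)) =
      (\<Sum>k = 0..n - 1. f (real k / real n)) + (f 1 - f 0)"
    by simp
  then show ?thesis
    unfolding left_Riemann_sum_def right_Riemann_sum_def by (simp add: distrib_left diff_divide_distrib)
qed

theorem theorem2p6:
  fixes p :: "real poly"
  assumes "degree p \<le> 3"
  shows "(mono_on {1..} (left_Riemann_sum (poly p)) \<longleftrightarrow>
            poly p 0 \<le> min (poly p 1) (poly p (1 / 2))) \<and>
         (antimono_on {1..} (left_Riemann_sum (poly p)) \<longleftrightarrow>
            poly p 0 \<ge> max (poly p 1) (poly p (1 / 2))) \<and>
         (mono_on {1..} (right_Riemann_sum (poly p)) \<longleftrightarrow>
            poly p 1 \<le> min (poly p 0) (poly p (1 / 2))) \<and>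
         (antimono_on {1..} (right_Riemann_sum (poly p)) \<longleftrightarrow>
            poly p 1 \<ge> max (poly p 0) (poly p (1 / 2)))"
proof -
  define B where "B = (poly p 1 - poly p 0) / 2"
  define C where "C = (poly p 0 + poly p 1 - 2 * poly p (1 / 2)) / 3"
  obtain I where L: "\<And>n. n \<ge> 1 \<Longrightarrow>
      left_Riemann_sum (poly p) n = I - B / real n + C / (real n)\<^sup>2"
    using left_Riemann_sum_cubic[OF assms] unfolding B_def C_def by blast
  have R: "right_Riemann_sum (poly p) n = I - (- B) / real n + C / (real n)\<^sup>2" if "n \<ge> 1" for n
    using that by (simp add: right_Riemann_sum_eq_left L B_def field_simps)
  have left: "B - 3 / 2 * C = poly p (1 / 2) - poly p 0"
    by (simp add: B_def C_def field_simps)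
  have right: "- B - 3 / 2 * C = poly p (1 / 2) - poly p 1"
    by (simp add: B_def C_def field_simps)
  have "mono_on {1..} (left_Riemann_sum (poly p)) \<longleftrightarrow>
      0 \<le> B \<and> 0 \<le> poly p (1 / 2) - poly p 0"
    using mono_on_quadratic_in_inverse_iff[OF L] by (simp only: left)
  moreover have "antimono_on {1..} (left_Riemann_sum (poly p)) \<longleftrightarrow>
      B \<le> 0 \<and> poly p (1 / 2) - poly p 0 \<le> 0"
    using antimono_on_quadratic_in_inverse_iff[OF L] by (simp only: left)
  moreover have "mono_on {1..} (right_Riemann_sum (poly p)) \<longleftrightarrow>
      0 \<le> - B \<and> 0 \<le> poly p (1 / 2) - poly p 1"
    using mono_on_quadratic_in_inverse_iff[OF R] by (simp only: right)
  moreover have "antimono_on {1..} (right_Riemann_sum (poly p)) \<longleftrightarrow>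
      - B \<le> 0 \<and> poly p (1 / 2) - poly p 1 \<le> 0"
    using antimono_on_quadratic_in_inverse_iff[OF R] by (simp only: right)
  ultimately show ?thesis
    unfolding B_def min.bounded_iff max.bounded_iff by argo
qed

end
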